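(* Let $\mathcal D\subseteq\mathbb R^{d}$ be a closed convex set, and let $f$ and $g_0,g_1,\dots,g_\tau$ be proper, convex, lower semicontinuous functions of $(\mathbf x,\boldsymbol\lambda)\in\mathbb R^n\times\mathbb R^{d}$ with values in $\mathbb R\cup\{+\infty\}$. Suppose that for every $\boldsymbol\lambda\in\mathcal D$, $$\bigcap_{i=0}^{\tau}\operatorname{ri}\big(\operatorname{dom} g_i(\cdot,\boldsymbol\lambda)\big)\neq\emptyset .$$ Then the bilevel problem $$\min_{\mathbf x\in\mathbb R^n,\ \boldsymbol\lambda\in\mathcal D} f(\mathbf x,\boldsymbol\lambda)\quad\text{s.t.}\quad \mathbf x\in\operatorname*{arg\,min}_{\hat{\mathbf x}\in\mathbb R^n}\ \sum_{i=0}^{\tau}g_i(\hat{\mathbf x},\boldsymbol\lambda)$$ is equivalent to the single-level problem $$\min_{\mathbf x\in\mathbb R^n,\ \boldsymbol\rho_1,\dots,\boldsymbol\rho_\tau\in\mathbb R^n,\ \boldsymbol\lambda\in\mathcal D} f(\mathbf x,\boldsymbol\lambda)\quad\text{s.t.}\quad \sum_{i=0}^{\tau}g_i(\mathbf x,\boldsymbol\lambda)+g_0^*\Big(-\sum_{i=1}^{\tau}\boldsymbol\rho_i,\boldsymbol\lambda\Big)+\sum_{i=1}^{\tau}g_i^*(\boldsymbol\rho_i,\boldsymbol\lambda)\le 0 .$$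
   Context: $\operatorname{ri}$ denotes relative interior, and $\operatorname{dom} g_i(\cdot,\boldsymbol\lambda)=\{\mathbf x: g_i(\mathbf x,\boldsymbol\lambda)<+\infty\}$. The conjugate is taken with respect to the first variable: $g_i^*(\mathbf y,\boldsymbol\lambda):=\sup_{\mathbf x\in\mathbb R^n}\{\mathbf y^T\mathbf x-g_i(\mathbf x,\boldsymbol\lambda)\}$. "Equivalent" means: a pair $(\mathbf x,\boldsymbol\lambda)$ with $\boldsymbol\lambda\in\mathcal D$ is feasible for the bilevel problem if and only if there exist $\boldsymbol\rho_1,\dots,\boldsymbol\rho_\tau\in\mathbb R^n$ such that $(\mathbf x,\boldsymbol\rho_1,\dots,\boldsymbol\rho_\tau,\boldsymbol\lambda)$ is feasible for the single-level problem (the objectives being identical). *)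

theory Defs
  imports "HOL-Analysis.Analysis"
begin

text \<open>
  Functions with values in the extended reals are maps into \<^typ>\<open>ereal\<close>; a function of
  \<open>(x, \<lambda>)\<close> takes a pair, so that joint convexity and semicontinuity refer to the product space.
\<close>

definition proper_fun :: "('a \<Rightarrow> ereal) \<Rightarrow> bool" where
  "proper_fun h \<longleftrightarrow> (\<forall>z. h z \<noteq> -\<infinity>) \<and> (\<exists>z. h z < \<infinity>)"

text \<open>
  The library's \<^const>\<open>convex_on\<close> is restricted to real-valued functions. Below, the
  convention \<open>0 * \<infinity> = 0\<close> of \<^typ>\<open>ereal\<close> makes the cases \<open>u = 0\<close> and \<open>v = 0\<close> trivial.
\<close>

definition convex_fun :: "('a::real_vector \<Rightarrow> ereal) \<Rightarrow> bool" where
  "convex_fun h \<longleftrightarrow>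
    (\<forall>z w. \<forall>u\<ge>0. \<forall>v\<ge>0. u + v = 1 \<longrightarrow>
      h (u *\<^sub>R z + v *\<^sub>R w) \<le> ereal u * h z + ereal v * h w)"

definition lsc_fun :: "('a::topological_space \<Rightarrow> ereal) \<Rightarrow> bool" where
  "lsc_fun h \<longleftrightarrow> (\<forall>z. h z \<le> Liminf (at z) h)"

definition effective_dom :: "('a \<Rightarrow> ereal) \<Rightarrow> 'a set" where
  "effective_dom h = {x. h x < \<infinity>}"

definition partial_conjugate :: "('a::real_inner \<times> 'b \<Rightarrow> ereal) \<Rightarrow> 'a \<times> 'b \<Rightarrow> ereal" where
  "partial_conjugate h = (\<lambda>(y, l). SUP x. ereal (y \<bullet> x) - h (x, l))"

record 'v min_problem =
  feasible :: "'v set"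
  objective :: "'v \<Rightarrow> ereal"

definition bilevel_problem ::
  "(real^'d) set \<Rightarrow> ((real^'n) \<times> (real^'d) \<Rightarrow> ereal) \<Rightarrow> nat \<Rightarrow>
   (nat \<Rightarrow> (real^'n) \<times> (real^'d) \<Rightarrow> ereal) \<Rightarrow> ((real^'n) \<times> (real^'d)) min_problem" where
  "bilevel_problem D f \<tau> g =
    \<lparr> feasible = {(x, l). l \<in> D \<and> is_arg_min (\<lambda>x'. \<Sum>i=0..\<tau>. g i (x', l)) (\<lambda>_. True) x},
      objective = (\<lambda>(x, l). f (x, l)) \<rparr>"

text \<open>
  A tuple \<open>(\<rho>\<^sub>1, \<dots>, \<rho>\<^sub>\<tau>)\<close> is an extensional function on \<open>{1..\<tau>}\<close>. If all \<open>g i\<close> are proper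
  and no \<open>g i (\<cdot>, l)\<close> is identically \<open>\<infinity>\<close>, no term of the constraint is \<open>-\<infinity>\<close>, so the
  sum never involves \<open>\<infinity> - \<infinity>\<close>.
\<close>

definition single_level_problem ::
  "(real^'d) set \<Rightarrow> ((real^'n) \<times> (real^'d) \<Rightarrow> ereal) \<Rightarrow> nat \<Rightarrow>
   (nat \<Rightarrow> (real^'n) \<times> (real^'d) \<Rightarrow> ereal) \<Rightarrow>
   ((real^'n) \<times> (nat \<Rightarrow> (real^'n)) \<times> (real^'d)) min_problem" where
  "single_level_problem D f \<tau> g =
    \<lparr> feasible = {(x, \<rho>, l). \<rho> \<in> {1..\<tau>} \<rightarrow>\<^sub>E UNIV \<and> l \<in> D \<and>
        (\<Sum>i=0..\<tau>. g i (x, l)) + partial_conjugate (g 0) (- (\<Sum>i=1..\<tau>. \<rho> i), l)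
          + (\<Sum>i=1..\<tau>. partial_conjugate (g i) (\<rho> i, l)) \<le> 0},
      objective = (\<lambda>(x, \<rho>, l). f (x, l)) \<rparr>"

text \<open>
  Equivalence of a problem in \<open>(x, l)\<close> with a lifted problem in \<open>(x, \<rho>, l)\<close>: \<open>\<rho>\<close> is an
  auxiliary variable that does not influence the objective.
\<close>

definition equivalent_problems ::
  "'c set \<Rightarrow> ('a \<times> 'c) min_problem \<Rightarrow> ('a \<times> 'b \<times> 'c) min_problem \<Rightarrow> bool" where
  "equivalent_problems D P Q \<longleftrightarrow>
    (\<forall>x. \<forall>l\<in>D. (x, l) \<in> feasible P \<longleftrightarrow> (\<exists>\<rho>. (x, \<rho>, l) \<in> feasible Q)) \<and>
    (\<forall>x \<rho> l. objective Q (x, \<rho>, l) = objective P (x, l))"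

end

theory Submission
  imports Defs
begin

text \<open>
  For a fixed \<open>l\<close>, the lower level minimizes the sum of the convex functions \<open>h i = g i (\<cdot>, l)\<close>.
  Write \<open>\<sigma> 0 = - (\<rho> 1 + \<dots> + \<rho> \<tau>)\<close> and \<open>\<sigma> i = \<rho> i\<close> for \<open>i \<ge> 1\<close>. The tuples \<open>\<rho>\<close> then become the
  families \<open>\<sigma>\<close> with sum zero, and the constraint of the single-level problem becomes
  \<open>(\<Sum>i. h i x) + (\<Sum>i. conjugate (h i) (\<sigma> i)) \<le> 0\<close>, in which all indices play the same role.

  If the constraint holds, then \<open>x\<close> is a minimizer by weak duality: adding up the Fenchel-Young
  inequalities at any \<open>z\<close>, the linear terms cancel because the \<open>\<sigma> i\<close> sum to zero, and the sum of
  the conjugates is at least \<open>- (\<Sum>i. h i z)\<close> (\<open>minimizer_sum_if_conjugate_bound\<close>).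

  Conversely, \<open>x\<close> minimizes the sum exactly if \<open>0\<close> is a subgradient of the sum at \<open>x\<close>. The common
  point of the relative interiors makes the Moreau-Rockafellar sum rule valid, so that \<open>0\<close> is a sum
  of subgradients \<open>\<sigma> i\<close> of the single functions \<open>h i\<close> at \<open>x\<close> (\<open>subgradient_sum_split\<close>). At a
  subgradient the Fenchel-Young inequality is an equality, and so the left-hand side of the
  constraint is zero.

  The sum rule is where the work lies. It reduces by induction to two functions
  (\<open>subgradient_add_split\<close>), for which it follows from separating a convex set in
  \<open>\<real>\<^sup>n \<times> \<real>\<close> from the origin; the condition on relative interiors excludes a vertical hyperplane.
\<close>

section \<open>Convex functions with extended real values\<close>

definition subgradient :: "('a::real_inner \<Rightarrow> ereal) \<Rightarrow> 'a \<Rightarrow> 'a \<Rightarrow> bool" where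
  "subgradient h x y \<longleftrightarrow> (\<forall>z. h x + ereal (y \<bullet> (z - x)) \<le> h z)"

definition conjugate :: "('a::real_inner \<Rightarrow> ereal) \<Rightarrow> 'a \<Rightarrow> ereal" where
  "conjugate h y = (SUP x. ereal (y \<bullet> x) - h x)"

text \<open>
  The epigraph is taken strict so that the set separated in the sum rule misses the origin, even
  though the subgradient inequality is an equality at the base point.
\<close>

definition strict_epigraph :: "('a \<Rightarrow> ereal) \<Rightarrow> ('a \<times> real) set" where
  "strict_epigraph h = {(z, r). h z < ereal r}"

lemma convex_fun_slice:
  fixes g :: "'a::real_vector \<times> 'b::real_vector \<Rightarrow> ereal"
  assumes "convex_fun g"
  shows "convex_fun (\<lambda>x. g (x, l))"
proof -
  have "g (u *\<^sub>R z + v *\<^sub>R w, l) \<le> ereal u * g (z, l) + ereal v * g (w, l)"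
    if uv: "u \<ge> 0" "v \<ge> 0" "u + v = 1" for z w u v
  proof -
    have "u *\<^sub>R l + v *\<^sub>R l = l"
      using uv(3) by (metis scaleR_add_left scaleR_one)
    then show ?thesis
      using assms uv unfolding convex_fun_def
      by (metis (no_types, lifting) add_Pair scaleR_Pair)
  qed
  then show ?thesis by (auto simp: convex_fun_def)
qed

lemma convex_strict_epigraph:
  assumes cvx: "convex_fun h" and nm: "\<And>z. h z \<noteq> -\<infinity>"
  shows "convex (strict_epigraph h)"
proof (rule convexI, clarsimp simp: strict_epigraph_def)
  fix z r w s u v
  assume hz: "h z < ereal r" and hw: "h w < ereal s"
    and uv: "0 \<le> (u::real)" "0 \<le> (v::real)" "u + v = 1"
  obtain a b where ab: "h z = ereal a" "h w = ereal b"
    using hz hw nm[of z] nm[of w] by (cases "h z"; cases "h w") auto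
  have "a < r" "b < s" using ab hz hw by auto
  have "u * a + v * b < u * r + v * s"
  proof (cases "u = 0")
    case True then show ?thesis using uv \<open>b < s\<close> by simp
  next
    case False
    then have "u * a < u * r" using uv \<open>a < r\<close> by simp
    moreover have "v * b \<le> v * s" using uv \<open>b < s\<close> by (simp add: mult_left_mono)
    ultimately show ?thesis by linarith
  qed
  moreover have "h (u *\<^sub>R z + v *\<^sub>R w) \<le> ereal (u * a + v * b)"
    using cvx uv ab unfolding convex_fun_def
    by (metis plus_ereal.simps(1) times_ereal.simps(1))
  ultimately show "h (u *\<^sub>R z + v *\<^sub>R w) < ereal (u * r + v * s)"
    by (meson ereal_less(2) le_less_trans less_ereal.simps(1))
qed

lemma convex_effective_dom:
  assumes "convex_fun h" and "\<And>z. h z \<noteq> -\<infinity>"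
  shows "convex (effective_dom h)"
proof -
  have "effective_dom h = fst ` strict_epigraph h"
  proof -
    have "\<exists>r. h x < ereal r" if "h x < \<infinity>" for x
      using ereal_dense2[OF that] by auto
    then show ?thesis
      by (force simp: effective_dom_def strict_epigraph_def image_iff less_le_trans)
  qed
  then show ?thesis
    using convex_linear_image[OF linear_fst convex_strict_epigraph[OF assms]] by simp
qed

text \<open>Turns an inequality on a strict epigraph back into one on the function.\<close>

lemma ereal_le_if_upper_bounds:
  assumes "\<And>r. a < ereal r \<Longrightarrow> c \<le> r"
  shows "ereal c \<le> a"
proof (rule ccontr)
  assume "\<not> ereal c \<le> a"
  then obtain r where "a < ereal r" "ereal r < ereal c"
    using ereal_dense2[of a "ereal c"] by (metis not_le)
  then show False using assms[of r] by simp
qed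

lemma sum_ereal_not_MInf:
  fixes a :: "'i \<Rightarrow> ereal"
  assumes "\<And>i. i \<in> I \<Longrightarrow> a i \<noteq> -\<infinity>"
  shows "(\<Sum>i\<in>I. a i) \<noteq> -\<infinity>"
  using assms by (induction I rule: infinite_finite_induct) auto

lemma convex_fun_sum:
  assumes "\<And>i. i \<in> I \<Longrightarrow> convex_fun (h i)"
  shows "convex_fun (\<lambda>z. \<Sum>i\<in>I. h i z)"
proof -
  have "(\<Sum>i\<in>I. h i (u *\<^sub>R z + v *\<^sub>R w)) \<le> ereal u * (\<Sum>i\<in>I. h i z) + ereal v * (\<Sum>i\<in>I. h i w)"
    if uv: "u \<ge> 0" "v \<ge> 0" "u + v = 1" for z w u v
  proof -
    have "(\<Sum>i\<in>I. h i (u *\<^sub>R z + v *\<^sub>R w)) \<le> (\<Sum>i\<in>I. ereal u * h i z + ereal v * h i w)"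
      using assms uv by (intro sum_mono) (auto simp: convex_fun_def)
    also have "\<dots> = (\<Sum>i\<in>I. ereal u * h i z) + (\<Sum>i\<in>I. ereal v * h i w)"
      by (rule sum.distrib)
    also have "(\<Sum>i\<in>I. ereal u * h i z) = ereal u * (\<Sum>i\<in>I. h i z)"
      using sum_distrib_right_ereal[of u "\<lambda>i. h i z" I] uv(1) by (simp add: mult.commute)
    also have "(\<Sum>i\<in>I. ereal v * h i w) = ereal v * (\<Sum>i\<in>I. h i w)"
      using sum_distrib_right_ereal[of v "\<lambda>i. h i w" I] uv(2) by (simp add: mult.commute)
    finally show ?thesis .
  qed
  then show ?thesis by (auto simp: convex_fun_def)
qed

section \<open>The sum rule for subgradients\<close>

text \<open>
  From a relative interior point one can move a little away from any \<open>z\<close> and stay in \<open>S\<close>; if \<open>p\<close>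
  were larger at \<open>z\<close>, it would drop below its minimum there.
\<close>

lemma linear_minimal_at_rel_interior_constant:
  fixes S :: "'a::euclidean_space set"
  assumes "convex S" and z0: "z0 \<in> rel_interior S"
    and min: "\<And>z. z \<in> S \<Longrightarrow> p \<bullet> z0 \<le> p \<bullet> z" and "z \<in> S"
  shows "p \<bullet> z = p \<bullet> z0"
proof -
  obtain e where e: "e > 1" "(1 - e) *\<^sub>R z + e *\<^sub>R z0 \<in> S"
    using convex_rel_interior_iff[of S z0] assms by auto
  have "p \<bullet> z0 \<le> (1 - e) * (p \<bullet> z) + e * (p \<bullet> z0)"
    using min[OF e(2)] by (simp add: inner_add_right)
  then have "(e - 1) * (p \<bullet> z) \<le> (e - 1) * (p \<bullet> z0)" by (simp add: algebra_simps)
  then have "p \<bullet> z \<le> p \<bullet> z0" using e(1) by simp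
  then show ?thesis using min[OF \<open>z \<in> S\<close>] by simp
qed

text \<open>
  Consider the convex set \<open>C\<close> of all pairs \<open>(z - w, t)\<close> for which \<open>t\<close> exceeds
  \<open>(f z + g w) - (f x + g x) - y \<bullet> (w - x)\<close>. That \<open>y\<close> is a subgradient of \<open>f + g\<close> says that this
  quantity is nonnegative for \<open>z = w\<close>, so \<open>0 \<notin> C\<close> and some nonzero \<open>(p, \<sigma>)\<close> in the span of \<open>C\<close>
  satisfies \<open>p \<bullet> u + \<sigma> * t \<ge> 0\<close> on \<open>C\<close>. If \<open>\<sigma> > 0\<close>, then \<open>k = p / \<sigma>\<close> gives the splitting
  \<open>y = - k + (y + k)\<close>: the inequality for \<open>w = x\<close> involves only \<open>f\<close>, the one for \<open>z = x\<close> only \<open>g\<close>.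
\<close>

lemma subgradient_add_split:
  fixes f g :: "'a::euclidean_space \<Rightarrow> ereal"
  assumes f: "convex_fun f" "\<And>z. f z \<noteq> -\<infinity>" and g: "convex_fun g" "\<And>z. g z \<noteq> -\<infinity>"
    and ri: "z0 \<in> rel_interior (effective_dom f)" "z0 \<in> rel_interior (effective_dom g)"
    and fx: "f x = ereal a" and gx: "g x = ereal b"
    and sub: "subgradient (\<lambda>z. f z + g z) x y"
  obtains y1 y2 where "subgradient f x y1" "subgradient g x y2" "y = y1 + y2"
proof -
  have dom: "\<exists>r. h z < ereal r" if "z \<in> effective_dom h" for h :: "'a \<Rightarrow> ereal" and z
    using that ereal_dense2[of "h z" \<infinity>] by (auto simp: effective_dom_def)
  have z0: "z0 \<in> effective_dom f" "z0 \<in> effective_dom g"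
    using ri rel_interior_subset by auto
  let ?c = "a + b - y \<bullet> x"
  define L :: "('a \<times> real) \<times> ('a \<times> real) \<Rightarrow> 'a \<times> real"
    where "L = (\<lambda>((z, r), (w, s)). (z - w, r + s - y \<bullet> w))"
  define C where "C = (\<lambda>q. (0, - ?c) + q) ` L ` (strict_epigraph f \<times> strict_epigraph g)"
  have C_iff: "(z - w, r + s - y \<bullet> w - ?c) \<in> C" if "f z < ereal r" "g w < ereal s" for z w r s
    unfolding C_def L_def using that
    by (force simp: strict_epigraph_def image_iff intro!: bexI[of _ "((z, r), (w, s))"])
  have C_elim: "\<exists>z w r s. f z < ereal r \<and> g w < ereal s \<and> q = (z - w, r + s - y \<bullet> w - ?c)"
    if "q \<in> C" for q
    using that unfolding C_def L_def by (fastforce simp: strict_epigraph_def)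
  have "linear L"
    unfolding L_def by (rule linearI) (auto simp: algebra_simps inner_add_right)
  then have "convex C"
    unfolding C_def
    by (intro convex_translation convex_linear_image convex_Times convex_strict_epigraph f g)
  moreover have "0 \<notin> C"
  proof
    assume "0 \<in> C"
    then obtain z r s where rs: "f z < ereal r" "g z < ereal s" "r + s - y \<bullet> z - ?c = 0"
      using C_elim[of 0] by (auto simp: zero_prod_def)
    have "ereal (a + b + y \<bullet> (z - x)) \<le> f z + g z"
      using sub fx gx by (auto simp: subgradient_def)
    also have "\<dots> < ereal r + ereal s"
      using rs(1,2) f(2) g(2) by (intro ereal_add_strict_mono2) auto
    finally show False using rs(3) by (simp add: inner_diff_right)
  qed
  moreover have "C \<noteq> {}" using C_iff dom z0 by blast
  ultimately obtain d where d: "d \<in> span C" "d \<noteq> 0" "\<And>q. q \<in> C \<Longrightarrow> 0 \<le> d \<bullet> q"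
    using separating_hyperplane_set_0_inspan[of C] by blast
  obtain p \<sigma> where d_eq: "d = (p, \<sigma>)" by (cases d)
  have sep: "0 \<le> p \<bullet> (z - w) + \<sigma> * (r + s - y \<bullet> w - ?c)"
    if "f z < ereal r" "g w < ereal s" for z w r s
    using d(3)[OF C_iff[OF that]] by (simp add: d_eq)
  (* C is closed upwards in its last coordinate, so a negative \<sigma> would make d unbounded below. *)
  have "\<sigma> \<ge> 0"
  proof (rule ccontr)
    assume neg: "\<not> \<sigma> \<ge> 0"
    obtain r s where rs: "f z0 < ereal r" "g z0 < ereal s" using z0 dom by blast
    let ?t = "\<bar>r + s - y \<bullet> z0 - ?c\<bar> + 1"
    have "f z0 < ereal (r + ?t)"
      using rs(1) by (rule less_trans) simp
    from sep[OF this rs(2)] have "0 \<le> \<sigma> * (r + ?t + s - y \<bullet> z0 - ?c)" by simp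
    moreover have "0 < r + ?t + s - y \<bullet> z0 - ?c" by linarith
    ultimately show False using neg by (simp add: zero_le_mult_iff)
  qed
  (* If \<sigma> = 0, then p separates the two domains. Their relative interiors meet, so p takes a single
     value on both of them, and (p, 0) is orthogonal to C although it is a nonzero vector of its
     span. *)
  moreover have "\<sigma> \<noteq> 0"
  proof
    assume s0: "\<sigma> = 0"
    have le: "p \<bullet> w \<le> p \<bullet> z" if zw: "z \<in> effective_dom f" "w \<in> effective_dom g" for z w
    proof -
      obtain r s where "f z < ereal r" "g w < ereal s" using zw dom by blast
      from sep[OF this] show ?thesis by (simp add: s0 inner_diff_right)
    qed
    have pf: "p \<bullet> z = p \<bullet> z0" if "z \<in> effective_dom f" for z
      using linear_minimal_at_rel_interior_constant[OF convex_effective_dom[OF f] ri(1)]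
        le z0 that by blast
    have pg: "p \<bullet> w = p \<bullet> z0" if "w \<in> effective_dom g" for w
      using linear_minimal_at_rel_interior_constant[OF convex_effective_dom[OF g] ri(2), of "-p" w]
        le z0 that by auto
    have "d \<bullet> q = 0" if q_in: "q \<in> C" for q
    proof -
      obtain z w r s where q: "f z < ereal r" "g w < ereal s" "q = (z - w, r + s - y \<bullet> w - ?c)"
        using C_elim[OF q_in] by blast
      then have "z \<in> effective_dom f" "w \<in> effective_dom g"
        by (auto simp: effective_dom_def less_le_trans)
      then show ?thesis using pf pg q(3) by (simp add: d_eq s0 inner_diff_right)
    qed
    then have "d \<bullet> d = 0"
      using d(1) by (metis orthogonal_def orthogonal_to_span orthogonal_commute)
    then show False using d(2) by simp
  qed
  ultimately have pos: "\<sigma> > 0" by simp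
  define k where "k = p /\<^sub>R \<sigma>"
  have key: "a + b + y \<bullet> (w - x) - k \<bullet> (z - w) \<le> r + s"
    if "f z < ereal r" "g w < ereal s" for z w r s
  proof -
    have "p = \<sigma> *\<^sub>R k" using pos by (simp add: k_def)
    then have "0 \<le> \<sigma> * (k \<bullet> (z - w) + (r + s - y \<bullet> w - ?c))"
      using sep[OF that] by (simp add: algebra_simps)
    then show ?thesis using pos by (simp add: zero_le_mult_iff inner_diff_right)
  qed
  have "subgradient f x (- k)"
    unfolding subgradient_def fx plus_ereal.simps
  proof (intro allI ereal_le_if_upper_bounds)
    fix z r assume "f z < ereal r"
    then have "a + (- k) \<bullet> (z - x) \<le> r + e" if "e > 0" for e
      using key[of z r x "b + e"] gx that by simp
    then show "a + (- k) \<bullet> (z - x) \<le> r" by (rule field_le_epsilon)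
  qed
  moreover have "subgradient g x (y + k)"
    unfolding subgradient_def gx plus_ereal.simps
  proof (intro allI ereal_le_if_upper_bounds)
    fix w s assume "g w < ereal s"
    then have "b + (y + k) \<bullet> (w - x) \<le> s + e" if "e > 0" for e
      using key[of x "a + e" w s] fx that by (simp add: algebra_simps)
    then show "b + (y + k) \<bullet> (w - x) \<le> s" by (rule field_le_epsilon)
  qed
  ultimately show ?thesis by (rule that) simp
qed

lemma effective_dom_add:
  assumes "\<And>z. f z \<noteq> -\<infinity>" "\<And>z. g z \<noteq> -\<infinity>"
  shows "effective_dom (\<lambda>z. f z + g z) = effective_dom f \<inter> effective_dom g"
  using assms by (auto simp: effective_dom_def)

lemma rel_interior_effective_dom_sum:
  fixes h :: "'i \<Rightarrow> 'a::euclidean_space \<Rightarrow> ereal"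
  assumes "finite I" "\<And>i. i \<in> I \<Longrightarrow> convex_fun (h i)"
    and "\<And>i z. i \<in> I \<Longrightarrow> h i z \<noteq> -\<infinity>"
    and "\<And>i. i \<in> I \<Longrightarrow> z0 \<in> rel_interior (effective_dom (h i))"
  shows "z0 \<in> rel_interior (effective_dom (\<lambda>z. \<Sum>i\<in>I. h i z))"
  using assms
proof (induction I)
  case empty
  then show ?case by (simp add: effective_dom_def)
next
  case (insert j I)
  let ?S = "\<lambda>z. \<Sum>i\<in>I. h i z"
  have nm: "?S z \<noteq> -\<infinity>" for z
    using insert.prems(2) by (intro sum_ereal_not_MInf) auto
  have "convex (effective_dom (h j))" "convex (effective_dom ?S)"
    using insert.prems nm convex_fun_sum[of I h] by (auto intro!: convex_effective_dom)
  moreover have "z0 \<in> rel_interior (effective_dom (h j)) \<inter> rel_interior (effective_dom ?S)"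
    using insert by auto
  ultimately have "z0 \<in> rel_interior (effective_dom (h j) \<inter> effective_dom ?S)"
    using convex_rel_interior_inter_two by blast
  then show ?case
    using insert nm by (simp add: effective_dom_add)
qed

text \<open>
  The Moreau-Rockafellar sum rule, by induction on the index set. The common relative interior
  point of the single domains is again one of the domain of each partial sum, which keeps the
  two-function case applicable.
\<close>

lemma subgradient_sum_split:
  fixes h :: "'i \<Rightarrow> 'a::euclidean_space \<Rightarrow> ereal"
  assumes "finite I" "\<And>i. i \<in> I \<Longrightarrow> convex_fun (h i)"
    and "\<And>i z. i \<in> I \<Longrightarrow> h i z \<noteq> -\<infinity>"
    and "\<And>i. i \<in> I \<Longrightarrow> z0 \<in> rel_interior (effective_dom (h i))"
    and "\<And>i. i \<in> I \<Longrightarrow> h i x < \<infinity>"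
    and "subgradient (\<lambda>z. \<Sum>i\<in>I. h i z) x y"
  shows "\<exists>\<rho>. (\<forall>i\<in>I. subgradient (h i) x (\<rho> i)) \<and> (\<Sum>i\<in>I. \<rho> i) = y"
  using assms
proof (induction I arbitrary: y)
  case empty
  have "0 + ereal (y \<bullet> ((x + y) - x)) \<le> 0"
    (* The empty sum is the zero function; testing its subgradient in direction y forces y = 0. *)
    using empty.prems(5) by (simp only: subgradient_def sum.empty)
  then have "y \<bullet> y \<le> 0" by simp
  then have "y = 0" using inner_gt_zero_iff[of y] by (meson not_le)
  then show ?case by simp
next
  case (insert j I)
  let ?S = "\<lambda>z. \<Sum>i\<in>I. h i z"
  have nm: "?S z \<noteq> -\<infinity>" for z
    using insert.prems(2) by (intro sum_ereal_not_MInf) auto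
  have fin: "?S x < \<infinity>"
    using insert by (simp add: sum_Pinfty less_top[symmetric])
  obtain a b where ab: "h j x = ereal a" "?S x = ereal b"
    using fin nm[of x] insert.prems(2)[of j x] insert.prems(4)[of j]
    by (cases "h j x"; cases "?S x") auto
  have "subgradient (\<lambda>z. h j z + ?S z) x y"
    using insert by simp
  moreover have "convex_fun ?S" "z0 \<in> rel_interior (effective_dom ?S)"
    using insert by (auto intro!: convex_fun_sum rel_interior_effective_dom_sum)
  ultimately obtain y1 y2
    where y: "subgradient (h j) x y1" "subgradient ?S x y2" "y = y1 + y2"
    using subgradient_add_split[of "h j" ?S z0 x a b y] insert.prems(1-3)[of j] nm ab by auto
  obtain \<rho> where \<rho>: "\<forall>i\<in>I. subgradient (h i) x (\<rho> i)" "(\<Sum>i\<in>I. \<rho> i) = y2"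
    using insert.IH[OF _ _ _ _ y(2)] insert.prems by auto
  have "(\<Sum>i\<in>I. (\<rho>(j := y1)) i) = y2"
    using insert.hyps \<rho>(2) by (metis (mono_tags, lifting) fun_upd_other sum.cong)
  then show ?case
    using insert.hyps \<rho>(1) y by (intro exI[of _ "\<rho>(j := y1)"]) auto
qed

section \<open>Minimizers of a sum and conjugates\<close>

lemma conjugate_upper: "ereal (y \<bullet> x) - h x \<le> conjugate h y"
  unfolding conjugate_def by (rule SUP_upper) simp

text \<open>Equality in the Fenchel-Young inequality: the supremum is attained at \<open>x\<close>.\<close>

lemma conjugate_at_subgradient:
  assumes "subgradient h x y" and hx: "h x = ereal b"
  shows "conjugate h y = ereal (y \<bullet> x - b)"
proof (rule antisym)
  show "conjugate h y \<le> ereal (y \<bullet> x - b)"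
    unfolding conjugate_def
  proof (rule SUP_least)
    fix z
    have "ereal (b + y \<bullet> (z - x)) \<le> h z"
      using assms by (simp add: subgradient_def)
    then show "ereal (y \<bullet> z) - h z \<le> ereal (y \<bullet> x - b)"
      by (cases "h z") (auto simp: inner_diff_right)
  qed
  show "ereal (y \<bullet> x - b) \<le> conjugate h y"
    using conjugate_upper[of y x h] hx by simp
qed

text \<open>
  Weak duality. If \<open>h i z\<close> is infinite for some \<open>i\<close>, there is nothing to prove; otherwise the
  lower bounds that the Fenchel-Young inequality at \<open>z\<close> gives for the conjugates are real, and their
  linear parts cancel in the sum.
\<close>

lemma minimizer_sum_if_conjugate_bound:
  assumes "finite I" and nm: "\<And>i z. i \<in> I \<Longrightarrow> h i z \<noteq> -\<infinity>"
    and \<sigma>: "(\<Sum>i\<in>I. \<sigma> i) = 0"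
    and le: "(\<Sum>i\<in>I. h i x) + (\<Sum>i\<in>I. conjugate (h i) (\<sigma> i)) \<le> 0"
  shows "(\<Sum>i\<in>I. h i x) \<le> (\<Sum>i\<in>I. h i z)"
proof (cases "\<exists>i\<in>I. h i z = \<infinity>")
  case True
  then have "(\<Sum>i\<in>I. h i z) = \<infinity>" using assms(1) by (auto simp: sum_Pinfty)
  then show ?thesis by simp
next
  case False
  define b where "b i = real_of_ereal (h i z)" for i
  have b: "h i z = ereal (b i)" if "i \<in> I" for i
    using that False nm[of i z] by (cases "h i z") (auto simp: b_def)
  have "(\<Sum>i\<in>I. \<sigma> i \<bullet> z - b i) = - (\<Sum>i\<in>I. b i)"
    using \<sigma> by (simp add: sum_subtractf flip: inner_sum_left)
  then have "ereal (- (\<Sum>i\<in>I. b i)) = (\<Sum>i\<in>I. ereal (\<sigma> i \<bullet> z) - h i z)"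
    using b by simp
  also have "\<dots> \<le> (\<Sum>i\<in>I. conjugate (h i) (\<sigma> i))"
    by (intro sum_mono conjugate_upper)
  finally have "(\<Sum>i\<in>I. h i x) + ereal (- (\<Sum>i\<in>I. b i)) \<le> 0"
    using le by (meson add_left_mono order_trans)
  then have "(\<Sum>i\<in>I. h i x) \<le> ereal (\<Sum>i\<in>I. b i)"
    by (cases "\<Sum>i\<in>I. h i x") auto
  then show ?thesis using b by simp
qed

text \<open>
  Strong duality. The common point \<open>z0\<close> of the domains makes the minimum finite, hence each \<open>h i x\<close>
  real, as the sum rule and the Fenchel-Young equality require.
\<close>

lemma conjugate_bound_if_minimizer_sum:
  fixes h :: "'i \<Rightarrow> 'a::euclidean_space \<Rightarrow> ereal"
  assumes "finite I" and "\<And>i. i \<in> I \<Longrightarrow> convex_fun (h i)"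
    and nm: "\<And>i z. i \<in> I \<Longrightarrow> h i z \<noteq> -\<infinity>"
    and ri: "\<And>i. i \<in> I \<Longrightarrow> z0 \<in> rel_interior (effective_dom (h i))"
    and min: "\<And>z. (\<Sum>i\<in>I. h i x) \<le> (\<Sum>i\<in>I. h i z)"
  shows "\<exists>\<sigma>. (\<Sum>i\<in>I. \<sigma> i) = 0 \<and>
    (\<Sum>i\<in>I. h i x) + (\<Sum>i\<in>I. conjugate (h i) (\<sigma> i)) \<le> 0"
proof -
  have "h i z0 < \<infinity>" if "i \<in> I" for i
    using ri[OF that] rel_interior_subset by (auto simp: effective_dom_def)
  then have "(\<Sum>i\<in>I. h i z0) \<noteq> \<infinity>" by (auto simp: sum_Pinfty)
  then have "(\<Sum>i\<in>I. h i x) \<noteq> \<infinity>" using min[of z0] by auto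
  then have fin: "h i x < \<infinity>" if "i \<in> I" for i
    using that assms(1) by (auto simp: sum_Pinfty)
  define b where "b i = real_of_ereal (h i x)" for i
  have b: "h i x = ereal (b i)" if "i \<in> I" for i
    using fin[OF that] nm[OF that, of x] by (cases "h i x") (auto simp: b_def)
  have "subgradient (\<lambda>z. \<Sum>i\<in>I. h i z) x 0"
    using min by (simp add: subgradient_def flip: zero_ereal_def)
  then obtain \<sigma> where \<sigma>: "\<forall>i\<in>I. subgradient (h i) x (\<sigma> i)" "(\<Sum>i\<in>I. \<sigma> i) = 0"
    using subgradient_sum_split[of I h z0 x 0] assms fin by blast
  have "(\<Sum>i\<in>I. conjugate (h i) (\<sigma> i)) = (\<Sum>i\<in>I. ereal (\<sigma> i \<bullet> x - b i))"
    using \<sigma>(1) b by (intro sum.cong refl conjugate_at_subgradient) auto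
  also have "\<dots> = ereal (- (\<Sum>i\<in>I. b i))"
    using \<sigma>(2) by (simp add: sum_subtractf flip: inner_sum_left)
  finally show ?thesis using \<sigma>(2) b by (intro exI[of _ \<sigma>]) simp
qed

lemma conjugate_eq_partial_conjugate:
  "partial_conjugate g (y, l) = conjugate (\<lambda>x. g (x, l)) y"
  by (simp add: partial_conjugate_def conjugate_def)

theorem theorem2p1:
  fixes D :: "(real^'d) set"
    and f :: "(real^'n) \<times> (real^'d) \<Rightarrow> ereal"
    and \<tau> :: nat
    and g :: "nat \<Rightarrow> (real^'n) \<times> (real^'d) \<Rightarrow> ereal"
  assumes "closed D" and "convex D"
    and "proper_fun f" and "convex_fun f" and "lsc_fun f"
    and "\<And>i. i \<le> \<tau> \<Longrightarrow> proper_fun (g i)"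
    and "\<And>i. i \<le> \<tau> \<Longrightarrow> convex_fun (g i)"
    and "\<And>i. i \<le> \<tau> \<Longrightarrow> lsc_fun (g i)"
    and "\<And>l. l \<in> D \<Longrightarrow>
      (\<Inter>i\<in>{0..\<tau>}. rel_interior (effective_dom (\<lambda>x. g i (x, l)))) \<noteq> {}"
  shows "equivalent_problems D (bilevel_problem D f \<tau> g) (single_level_problem D f \<tau> g)"
proof -
  have "(x, l) \<in> feasible (bilevel_problem D f \<tau> g) \<longleftrightarrow>
      (\<exists>\<rho>. (x, \<rho>, l) \<in> feasible (single_level_problem D f \<tau> g))" if l: "l \<in> D" for x l
  proof -
    define h where "h i = (\<lambda>z. g i (z, l))" for i
    have nm: "h i z \<noteq> -\<infinity>" if "i \<in> {0..\<tau>}" for i z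
      using assms(6)[of i] that by (simp add: h_def proper_fun_def)
    have cvx: "convex_fun (h i)" if "i \<in> {0..\<tau>}" for i
      unfolding h_def using assms(7)[of i] that by (intro convex_fun_slice) simp
    obtain z0 where z0: "\<And>i. i \<in> {0..\<tau>} \<Longrightarrow> z0 \<in> rel_interior (effective_dom (h i))"
      using assms(9)[OF l] unfolding h_def by blast
    have sum_head: "(\<Sum>i=0..\<tau>. c i) = c 0 + (\<Sum>i=1..\<tau>. c i)"
      for c :: "nat \<Rightarrow> 'z::comm_monoid_add"
      by (simp add: sum.atLeast_Suc_atMost)
    have bil: "(x, l) \<in> feasible (bilevel_problem D f \<tau> g) \<longleftrightarrow>
        (\<forall>z. (\<Sum>i=0..\<tau>. h i x) \<le> (\<Sum>i=0..\<tau>. h i z))"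
      using l by (auto simp: bilevel_problem_def is_arg_min_def h_def not_less)
    have sing: "(x, \<rho>, l) \<in> feasible (single_level_problem D f \<tau> g) \<longleftrightarrow>
        \<rho> \<in> {1..\<tau>} \<rightarrow>\<^sub>E UNIV \<and>
        (\<Sum>i=0..\<tau>. h i x) + (conjugate (h 0) (- (\<Sum>i=1..\<tau>. \<rho> i))
          + (\<Sum>i=1..\<tau>. conjugate (h i) (\<rho> i))) \<le> 0" for \<rho>
      using l by (simp add: single_level_problem_def conjugate_eq_partial_conjugate h_def add.assoc)
    show ?thesis
    proof
      assume "(x, l) \<in> feasible (bilevel_problem D f \<tau> g)"
      then obtain \<sigma> where \<sigma>: "(\<Sum>i=0..\<tau>. \<sigma> i) = 0"
        "(\<Sum>i=0..\<tau>. h i x) + (\<Sum>i=0..\<tau>. conjugate (h i) (\<sigma> i)) \<le> 0"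
        using conjugate_bound_if_minimizer_sum[of "{0..\<tau>}" h z0 x] cvx nm z0 bil by auto
      let ?\<rho> = "restrict \<sigma> {1..\<tau>}"
      have "\<sigma> 0 = - (\<Sum>i=1..\<tau>. ?\<rho> i)"
        using \<sigma>(1) sum_head[of \<sigma>] by (simp add: add_eq_0_iff2)
      then have "(x, ?\<rho>, l) \<in> feasible (single_level_problem D f \<tau> g)"
        unfolding sing using \<sigma>(2) sum_head[of "\<lambda>i. conjugate (h i) (\<sigma> i)"] by simp
      then show "\<exists>\<rho>. (x, \<rho>, l) \<in> feasible (single_level_problem D f \<tau> g)" by blast
    next
      assume "\<exists>\<rho>. (x, \<rho>, l) \<in> feasible (single_level_problem D f \<tau> g)"
      then obtain \<rho> where \<rho>: "(\<Sum>i=0..\<tau>. h i x) + (conjugate (h 0) (- (\<Sum>i=1..\<tau>. \<rho> i))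
          + (\<Sum>i=1..\<tau>. conjugate (h i) (\<rho> i))) \<le> 0"
        using sing by blast
      define \<sigma> where "\<sigma> = \<rho>(0 := - (\<Sum>i=1..\<tau>. \<rho> i))"
      have tail: "(\<Sum>i=1..\<tau>. c i (\<sigma> i)) = (\<Sum>i=1..\<tau>. c i (\<rho> i))"
        for c :: "nat \<Rightarrow> real^'n \<Rightarrow> 'z::comm_monoid_add"
        by (rule sum.cong) (auto simp: \<sigma>_def)
      have "(\<Sum>i=0..\<tau>. \<sigma> i) = 0"
        unfolding sum_head using tail[of "\<lambda>_ y. y"] by (simp add: \<sigma>_def)
      moreover have "(\<Sum>i=0..\<tau>. h i x) + (\<Sum>i=0..\<tau>. conjugate (h i) (\<sigma> i)) \<le> 0"
        using \<rho> tail[of "\<lambda>i. conjugate (h i)"]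
        unfolding sum_head[of "\<lambda>i. conjugate (h i) (\<sigma> i)"] by (simp add: \<sigma>_def)
      ultimately show "(x, l) \<in> feasible (bilevel_problem D f \<tau> g)"
        unfolding bil using minimizer_sum_if_conjugate_bound[of "{0..\<tau>}" h \<sigma> x] nm by auto
    qed
  qed
  then show ?thesis
    by (auto simp: equivalent_problems_def bilevel_problem_def single_level_problem_def)
qed

end
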